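(* Let $\mathcal{H}$ be a complex Hilbert space, let $A\neq 0$ be a positive bounded linear operator on $\mathcal{H}$, and let $\mathbb{A}=\begin{pmatrix}A&0\\0&A\end{pmatrix}$ on $\mathcal{H}\oplus\mathcal{H}$. Let $T\in\mathcal{B}_A(\mathcal{H})$ be such that $\mathcal{N}(A)^\perp$ is an invariant subspace for $T$. Then $$\omega_{\mathbb{A}}\left[\begin{pmatrix}I&T\\0&-I\end{pmatrix}\right]=\frac12\left(\left\|\begin{pmatrix}I&T\\0&-I\end{pmatrix}\right\|_{\mathbb{A}}+\left\|\begin{pmatrix}I&T\\0&-I\end{pmatrix}\right\|_{\mathbb{A}}^{-1}\right).$$
   Context: $\mathcal{B}(\mathcal{H})$ denotes the bounded linear operators on the complex Hilbert space $(\mathcal{H},\langle\cdot\mid\cdot\rangle)$, $I$ is the identity, and $\mathcal{R}(\cdot)$, $\mathcal{N}(\cdot)$ denote range and null space. $A\in\mathcal{B}(\mathcal{H})$ is positive, meaning $\langle Ax\mid x\rangle\ge 0$ for all $x$. $\mathcal{B}_A(\mathcal{H})$ is the set of $T\in\mathcal{B}(\mathcal{H})$ for which there is $S\in\mathcal{B}(\mathcal{H})$ with $AS=T^*A$ (equivalently $\mathcal{R}(T^*A)\subseteq\mathcal{R}(A)$). For a positive operator $B$ on a Hilbert space $\mathcal{K}$, put $\langle x\mid y\rangle_B=\langle Bx\mid y\rangle$ and $\|x\|_B=\sqrt{\langle x\mid x\rangle_B}$, and for an operator $X$ on $\mathcal{K}$ put $\|X\|_B=\sup\{\|Xx\|_B: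 x\in\mathcal{K},\ \|x\|_B=1\}$ and $\omega_B(X)=\sup\{|\langle Xx\mid x\rangle_B|: x\in\mathcal{K},\ \|x\|_B=1\}$. Here this is used with $\mathcal{K}=\mathcal{H}\oplus\mathcal{H}$ and $B=\mathbb{A}$. *)

theory Defs
  imports "HOL-Analysis.Analysis"
begin

text \<open>
  A complex inner product space is a real inner product space together with a compatible
  complex scalar multiplication and a complex inner product, linear in the first argument, whose
  real part is the given real inner product. Positive definiteness, the norm and the topology
  are thus inherited from \<^class>\<open>real_inner\<close>.
\<close>

class complex_inner = real_inner +
  fixes scaleC :: "complex \<Rightarrow> 'a \<Rightarrow> 'a" (infixr \<open>*\<^sub>C\<close> 75)
    and cinner :: "'a \<Rightarrow> 'a \<Rightarrow> complex"
  assumes scaleC_add_right: "c *\<^sub>C (x + y) = c *\<^sub>C x + c *\<^sub>C y"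
    and scaleC_add_left: "(c + d) *\<^sub>C x = c *\<^sub>C x + d *\<^sub>C x"
    and scaleC_scaleC: "c *\<^sub>C d *\<^sub>C x = (c * d) *\<^sub>C x"
    and scaleC_of_real: "complex_of_real r *\<^sub>C x = r *\<^sub>R x"
    and cinner_commute: "cinner x y = cnj (cinner y x)"
    and cinner_add_left: "cinner (x + y) z = cinner x z + cinner y z"
    and cinner_scaleC_left: "cinner (c *\<^sub>C x) y = c * cinner x y"
    and Re_cinner: "Re (cinner x y) = inner x y"

class chilbert_space = complex_inner + complete_space

text \<open>The Hilbert space direct sum of two spaces is their product type.\<close>

instantiation prod :: (complex_inner, complex_inner) complex_inner
begin

definition scaleC_prod_def: "c *\<^sub>C p = (c *\<^sub>C fst p, c *\<^sub>C snd p)"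

definition cinner_prod_def: "cinner p q = cinner (fst p) (fst q) + cinner (snd p) (snd q)"

instance
proof
  fix c d :: complex and r :: real and x y z :: "'a \<times> 'b"
  show "c *\<^sub>C (x + y) = c *\<^sub>C x + c *\<^sub>C y"
    by (simp add: scaleC_prod_def scaleC_add_right)
  show "(c + d) *\<^sub>C x = c *\<^sub>C x + d *\<^sub>C x"
    by (simp add: scaleC_prod_def scaleC_add_left)
  show "c *\<^sub>C d *\<^sub>C x = (c * d) *\<^sub>C x"
    by (simp add: scaleC_prod_def scaleC_scaleC)
  show "complex_of_real r *\<^sub>C x = r *\<^sub>R x"
    by (simp add: scaleC_prod_def scaleC_of_real scaleR_prod_def)
  show "cinner x y = cnj (cinner y x)"
    using cinner_commute[of "fst x" "fst y"] cinner_commute[of "snd x" "snd y"]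
    by (simp add: cinner_prod_def)
  show "cinner (x + y) z = cinner x z + cinner y z"
    by (simp add: cinner_prod_def cinner_add_left)
  show "cinner (c *\<^sub>C x) y = c * cinner x y"
    by (simp add: cinner_prod_def scaleC_prod_def cinner_scaleC_left distrib_left)
  show "Re (cinner x y) = inner x y"
    by (simp add: cinner_prod_def inner_prod_def Re_cinner)
qed

end

instance prod :: (chilbert_space, chilbert_space) chilbert_space ..

definition bounded_clinear :: "('a::complex_inner \<Rightarrow> 'b::complex_inner) \<Rightarrow> bool"
  where "bounded_clinear T \<longleftrightarrow> bounded_linear T \<and> (\<forall>c x. T (c *\<^sub>C x) = c *\<^sub>C T x)"

text \<open>On a Hilbert space the adjoint exists and is unique; see \<open>cinner_cadjoint\<close> and \<open>cadjoint_unique\<close> below.\<close>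

definition cadjoint :: "('a::complex_inner \<Rightarrow> 'b::complex_inner) \<Rightarrow> 'b \<Rightarrow> 'a"
  where "cadjoint T = (SOME S. \<forall>x y. cinner (T x) y = cinner x (S y))"

definition positive_op :: "('a::complex_inner \<Rightarrow> 'a) \<Rightarrow> bool"
  where "positive_op A \<longleftrightarrow> bounded_clinear A \<and> (\<forall>x. cinner (A x) x \<in> \<real>\<^sub>\<ge>\<^sub>0)"

definition null_space :: "('a::complex_inner \<Rightarrow> 'b::complex_inner) \<Rightarrow> 'a set"
  where "null_space A = {x. A x = 0}"

definition orth_complement :: "'a::complex_inner set \<Rightarrow> 'a set"
  where "orth_complement M = {x. \<forall>y\<in>M. cinner x y = 0}"

definition invariant_under :: "('a \<Rightarrow> 'a) \<Rightarrow> 'a set \<Rightarrow> bool"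
  where "invariant_under T M \<longleftrightarrow> T ` M \<subseteq> M"

definition ops_adj :: "('a::complex_inner \<Rightarrow> 'a) \<Rightarrow> ('a \<Rightarrow> 'a) set"  (\<open>\<B>\<^bsub>_\<^esub>\<close>)
  where "\<B>\<^bsub>A\<^esub> = {T. bounded_clinear T \<and> (\<exists>S. bounded_clinear S \<and> A \<circ> S = cadjoint T \<circ> A)}"

definition block_op ::
    "('a \<Rightarrow> 'c::plus) \<Rightarrow> ('b \<Rightarrow> 'c) \<Rightarrow> ('a \<Rightarrow> 'd::plus) \<Rightarrow> ('b \<Rightarrow> 'd) \<Rightarrow> 'a \<times> 'b \<Rightarrow> 'c \<times> 'd"
  where "block_op P Q R S = (\<lambda>(x, y). (P x + Q y, R x + S y))"

definition sinner :: "('a::complex_inner \<Rightarrow> 'a) \<Rightarrow> 'a \<Rightarrow> 'a \<Rightarrow> complex"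
  where "sinner B x y = cinner (B x) y"

text \<open>For positive \<open>B\<close> the number \<open>sinner B x x\<close> is real and nonnegative.\<close>

definition snorm :: "('a::complex_inner \<Rightarrow> 'a) \<Rightarrow> 'a \<Rightarrow> real"
  where "snorm B x = sqrt (Re (sinner B x x))"

text \<open>
  The suprema are taken in the reals, so they are meaningful when the respective set is bounded and
  nonempty, as it is for positive \<open>B \<noteq> 0\<close> and \<open>X \<in> \<B>\<^bsub>B\<^esub>\<close>.
\<close>

definition op_snorm :: "('a::complex_inner \<Rightarrow> 'a) \<Rightarrow> ('a \<Rightarrow> 'a) \<Rightarrow> real"
  where "op_snorm B X = Sup {snorm B (X x) | x. snorm B x = 1}"

definition num_radius :: "('a::complex_inner \<Rightarrow> 'a) \<Rightarrow> ('a \<Rightarrow> 'a) \<Rightarrow> real"  (\<open>\<omega>\<^bsub>_\<^esub>\<close>)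
  where "\<omega>\<^bsub>B\<^esub> X = Sup {cmod (sinner B (X x) x) | x. snorm B x = 1}"

lemma riesz_real:
  fixes g :: "'a::{real_inner, complete_space} \<Rightarrow> real"
  assumes "bounded_linear g"
  shows "\<exists>z. \<forall>x. g x = inner x z"
proof -
  interpret g: bounded_linear g by fact
  define J where "J x = (norm x)\<^sup>2 / 2 - g x" for x
  obtain K where K: "\<And>x. norm (g x) \<le> norm x * K"
    using g.bounded by blast
  have J_ge: "- (K\<^sup>2 / 2) \<le> J x" for x
  proof -
    have "g x \<le> norm x * K" using K[of x] by simp
    moreover have "0 \<le> (norm x - K)\<^sup>2" by simp
    ultimately show ?thesis unfolding J_def by (simp add: power2_diff algebra_simps)
  qed
  then have bdd: "bdd_below (range J)" by (intro bdd_belowI[of _ "- (K\<^sup>2 / 2)"]) auto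
  define m where "m = Inf (range J)"
  have m_le: "m \<le> J x" for x unfolding m_def by (rule cInf_lower[OF _ bdd]) simp
  have "\<exists>x. J x < m + 1 / real (Suc n)" for n
    using cInf_lessD[of "range J" "m + 1 / real (Suc n)"] unfolding m_def by auto
  then obtain X where X: "\<And>n. J (X n) < m + 1 / real (Suc n)" by metis
  have par: "(norm (a - b))\<^sup>2 / 4 = J a + J b - 2 * J ((1/2) *\<^sub>R (a + b))" for a b
    unfolding J_def power2_norm_eq_inner g.scaleR g.add
    by (simp add: inner_commute inner_add inner_diff field_simps)
  have dist_bound: "(norm (X i - X j))\<^sup>2 \<le> 4 / real (Suc i) + 4 / real (Suc j)" for i j
    using par[of "X i" "X j"] X[of i] X[of j] m_le[of "(1/2) *\<^sub>R (X i + X j)"] by argo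
  have "Cauchy X"
  proof (rule metric_CauchyI)
    fix e :: real assume "0 < e"
    then obtain N where N: "8 / e\<^sup>2 < real N" using reals_Archimedean2 by blast
    have "dist (X i) (X j) < e" if "N \<le> i" "N \<le> j" for i j
    proof -
      have "8 / e\<^sup>2 < real (Suc N)" using N by simp
      then have lt: "8 / real (Suc N) < e\<^sup>2" using \<open>0 < e\<close> by (simp add: field_simps)
      have "4 / real (Suc i) \<le> 4 / real (Suc N)" "4 / real (Suc j) \<le> 4 / real (Suc N)"
        using that by (auto intro!: divide_left_mono)
      with dist_bound[of i j] lt have "(norm (X i - X j))\<^sup>2 < e\<^sup>2" by argo
      then show ?thesis using \<open>0 < e\<close> by (simp add: dist_norm power2_less_imp_less)
    qed
    then show "\<exists>M. \<forall>i\<ge>M. \<forall>j\<ge>M. dist (X i) (X j) < e" by blast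
  qed
  then obtain z where z: "X \<longlonglongrightarrow> z" using Cauchy_convergent convergent_def by blast
  have "(\<lambda>n. J (X n)) \<longlonglongrightarrow> J z"
    unfolding J_def by (intro tendsto_intros z g.tendsto) simp
  moreover have "(\<lambda>n. m + 1 / real (Suc n)) \<longlonglongrightarrow> m + 0"
    by (intro tendsto_add tendsto_const LIMSEQ_Suc lim_1_over_n)
  ultimately have "J z \<le> m + 0"
    by (rule LIMSEQ_le) (use X less_imp_le in blast)
  then have min: "J z \<le> J y" for y using m_le[of y] by simp
  have "g x = inner x z" for x
  proof (cases "x = 0")
    case False
    define c where "c = inner x z - g x"
    define t where "t = - c / inner x x"
    have pos: "inner x x > 0" using False by simp
    have "J (z + t *\<^sub>R x) - J z = t * c + t\<^sup>2 * inner x x / 2"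
      unfolding J_def c_def power2_norm_eq_inner g.scaleR g.add
      by (simp add: inner_commute algebra_simps power2_eq_square)
    also have "\<dots> = - (c\<^sup>2 / (2 * inner x x))"
      using pos unfolding t_def by (simp add: field_simps power2_eq_square)
    finally have "c\<^sup>2 / (2 * inner x x) \<le> 0" using min[of "z + t *\<^sub>R x"] by simp
    then have "c\<^sup>2 \<le> 0" using pos by (simp add: divide_le_0_iff)
    then show ?thesis unfolding c_def by simp
  qed (simp add: g.zero)
  then show ?thesis by blast
qed

lemma cinner_cadjoint:
  fixes T :: "'a::chilbert_space \<Rightarrow> 'b::complex_inner"
  assumes "bounded_clinear T"
  shows "cinner (T x) y = cinner x (cadjoint T y)"
proof -
  have T: "bounded_linear T" and TC: "\<And>c x. T (c *\<^sub>C x) = c *\<^sub>C T x"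
    using assms by (auto simp: bounded_clinear_def)
  have "\<exists>z. \<forall>x. inner (T x) y = inner x z" for y
    by (rule riesz_real) (rule bounded_linear_compose[OF bounded_linear_inner_left T])
  then obtain S where S: "\<And>x y. inner (T x) y = inner x (S y)" by metis
  have "cinner (T x) y = cinner x (S y)" for x y
  proof (rule complex_eqI)
    show "Re (cinner (T x) y) = Re (cinner x (S y))" by (simp add: Re_cinner S)
    have "Re (cinner (T (\<i> *\<^sub>C x)) y) = Re (cinner (\<i> *\<^sub>C x) (S y))" by (simp only: Re_cinner S)
    then show "Im (cinner (T x) y) = Im (cinner x (S y))" by (simp add: TC cinner_scaleC_left)
  qed
  then have "\<exists>S. \<forall>x y. cinner (T x) y = cinner x (S y)" by blast
  then have "\<forall>x y. cinner (T x) y = cinner x (cadjoint T y)"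
    unfolding cadjoint_def by (rule someI_ex)
  then show ?thesis by blast
qed

lemma cadjoint_unique:
  fixes T :: "'a::chilbert_space \<Rightarrow> 'b::complex_inner"
  assumes "bounded_clinear T" and S: "\<And>x y. cinner (T x) y = cinner x (S y)"
  shows "S = cadjoint T"
proof
  fix y
  have "inner x (S y) = inner x (cadjoint T y)" for x
    using S[of x y] cinner_cadjoint[OF assms(1), of x y] by (simp flip: Re_cinner)
  then show "S y = cadjoint T y" by (metis vector_eq_ldot)
qed

end

theory Submission
  imports Defs
begin

text \<open>
  Let \<open>t\<close> be the operator seminorm of \<open>T\<close>.  On a vector \<open>(x, y)\<close> with seminorms \<open>a\<close> and \<open>b\<close> of its
  components, the block operator is controlled by the real matrix with rows \<open>(1, t)\<close> and \<open>(0, -1)\<close>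
  through the triangle and Cauchy--Schwarz inequalities.  Conversely, for a unit vector \<open>v\<close> with
  \<open>snorm A (T v)\<close> close to \<open>t\<close>, and \<open>u\<close> the normalization of \<open>T v\<close>, the block operator acts on the
  combinations of \<open>(u, 0)\<close> and \<open>(0, v)\<close> almost as this matrix does (lemma \<open>compression\<close>).  Its seminorm and
  numerical radius are therefore the norm and the numerical radius of the matrix.

  Put \<open>t = 2 sinh \<theta>\<close>.  The matrix has determinant \<open>-1\<close> and Hilbert--Schmidt norm squared
  \<open>2 + t\<^sup>2 = 2 cosh (2 \<theta>)\<close>, so its singular values are \<open>N = exp \<theta>\<close> and \<open>1 / N\<close>.  Its numerical radius is the largest eigenvalue of its symmetric part, whose trace is zero and whose determinant is
  \<open>- 1 - t\<^sup>2 / 4\<close>, that is \<open>cosh \<theta> = (N + 1 / N) / 2\<close>.  This is the asserted relation.  Below, \<open>N\<close> is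
  characterized by \<open>1 \<le> N\<close> and \<open>N - 1 / N = t\<close>, which turns all estimates into polynomial identities.

  The suprema are meaningful only if \<open>t\<close> is finite.  Finiteness is the analytic part of the proof: the
  existence of an adjoint for the semi-inner product implies boundedness in the seminorm, by Krein's
  argument (lemma \<open>symmetric_imp_snorm_bounded\<close>).
\<close>

section \<open>The semi-inner product of a positive operator\<close>

lemma cinner_add_right: "cinner x (y + z) = cinner x y + cinner x z"
  by (metis cinner_add_left cinner_commute complex_cnj_add)

lemma cinner_scaleC_right: "cinner x (c *\<^sub>C y) = cnj c * cinner x y"
  by (metis cinner_scaleC_left cinner_commute complex_cnj_mult)

text \<open>
  A vanishing \<open>q\<close> has to be admitted because the form \<open>sinner A\<close> may be degenerate; the polynomial
  is then affine, and being bounded below it is constant.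
\<close>

lemma nonneg_quadratic_imp_discriminant_le:
  fixes p q r :: real
  assumes "0 \<le> q" and "\<And>t. 0 \<le> p + 2 * t * r + t\<^sup>2 * q"
  shows "r\<^sup>2 \<le> p * q"
proof (cases "q = 0")
  case True
  have "r = 0"
  proof (rule ccontr)
    assume "r \<noteq> 0"
    then show False
      using assms(2)[of "- (p + 1) / (2 * r)"] True by (simp add: field_simps)
  qed
  then show ?thesis using True by simp
next
  case False
  then have q: "0 < q" using assms(1) by simp
  have "p + 2 * (- r / q) * r + (- r / q)\<^sup>2 * q = p - r\<^sup>2 / q"
    using q by (simp add: power2_eq_square)
  then have "r\<^sup>2 / q \<le> p" using assms(2)[of "- r / q"] by linarith
  then show ?thesis using q by (simp add: field_simps)
qed

locale positive_operator =
  fixes A :: "'a::complex_inner \<Rightarrow> 'a"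
  assumes pos: "positive_op A"
begin

lemma linear_A: "bounded_linear A"
  and A_scaleC: "A (c *\<^sub>C x) = c *\<^sub>C A x"
  using pos by (auto simp: positive_op_def bounded_clinear_def)

lemma sinner_add_left: "sinner A (x + y) z = sinner A x z + sinner A y z"
  by (simp add: sinner_def linear_add[OF bounded_linear.linear[OF linear_A]] cinner_add_left)

lemma sinner_add_right: "sinner A x (y + z) = sinner A x y + sinner A x z"
  by (simp add: sinner_def cinner_add_right)

lemma sinner_scaleC_left: "sinner A (c *\<^sub>C x) y = c * sinner A x y"
  by (simp add: sinner_def A_scaleC cinner_scaleC_left)

lemma sinner_scaleC_right: "sinner A x (c *\<^sub>C y) = cnj c * sinner A x y"
  by (simp add: sinner_def cinner_scaleC_right)

lemma sinner_scaleR_left: "sinner A (r *\<^sub>R x) y = of_real r * sinner A x y"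
  by (simp add: sinner_scaleC_left flip: scaleC_of_real)

lemma sinner_scaleR_right: "sinner A x (r *\<^sub>R y) = of_real r * sinner A x y"
  by (simp add: sinner_scaleC_right flip: scaleC_of_real)

lemma sinner_minus_left: "sinner A (- x) y = - sinner A x y"
  using sinner_scaleR_left[of "-1" x y] by simp

lemma sinner_minus_right: "sinner A x (- y) = - sinner A x y"
  using sinner_scaleR_right[of x "-1" y] by simp

lemmas sinner_simps = sinner_add_left sinner_add_right sinner_scaleR_left sinner_scaleR_right
  sinner_minus_left sinner_minus_right

lemma sinner_self_nonneg: "sinner A x x \<in> \<real>\<^sub>\<ge>\<^sub>0"
  using pos by (simp add: positive_op_def sinner_def)

lemma snorm_nonneg [simp]: "0 \<le> snorm A x"
  using sinner_self_nonneg[of x] by (simp add: snorm_def complex_nonneg_Reals_iff)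

lemma sinner_self: "sinner A x x = of_real ((snorm A x)\<^sup>2)"
  using sinner_self_nonneg[of x]
  by (simp add: snorm_def complex_nonneg_Reals_iff complex_eq_iff)

text \<open>
  Polarization: the diagonal values at \<open>x + y\<close> and \<open>\<i> x + y\<close> being real fixes the imaginary and
  the real part of \<open>sinner A y x\<close>.
\<close>

lemma sinner_commute: "sinner A y x = cnj (sinner A x y)"
proof -
  have real: "Im (sinner A z z) = 0" for z
    by (simp add: sinner_self)
  have "Im (sinner A x y) + Im (sinner A y x) = 0"
    using real[of "x + y"] by (simp add: sinner_simps real)
  moreover have "Re (sinner A x y) - Re (sinner A y x) = 0"
    using real[of "\<i> *\<^sub>C x + y"] real[of x] real[of y]
    by (simp add: sinner_simps sinner_scaleC_left sinner_scaleC_right)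
  ultimately show ?thesis
    by (simp add: complex_eq_iff)
qed

lemma A_symmetric: "cinner (A x) y = cinner x (A y)"
  using sinner_commute[of x y] cinner_commute[of x "A y"] by (simp add: sinner_def)

lemma snorm_scaleR: "snorm A (r *\<^sub>R x) = \<bar>r\<bar> * snorm A x"
  by (simp add: snorm_def sinner_simps real_sqrt_mult flip: power2_eq_square mult.assoc)

lemma snorm_add_power2:
  "(snorm A (x + y))\<^sup>2 = (snorm A x)\<^sup>2 + 2 * Re (sinner A x y) + (snorm A y)\<^sup>2"
proof -
  have "complex_of_real ((snorm A (x + y))\<^sup>2)
      = of_real ((snorm A x)\<^sup>2) + (sinner A x y + sinner A y x) + of_real ((snorm A y)\<^sup>2)"
    by (simp only: sinner_self[symmetric] sinner_simps) simp
  then show ?thesis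
    by (simp add: sinner_commute[of y x] complex_eq_iff)
qed

lemma Re_sinner_le: "Re (sinner A x y) \<le> snorm A x * snorm A y"
proof -
  let ?p = "(snorm A x)\<^sup>2" and ?r = "Re (sinner A x y)" and ?q = "(snorm A y)\<^sup>2"
  have quad: "0 \<le> ?p + 2 * t * ?r + t\<^sup>2 * ?q" for t
  proof -
    have "?p + 2 * t * ?r + t\<^sup>2 * ?q = (snorm A (x + t *\<^sub>R y))\<^sup>2"
      by (simp add: snorm_add_power2 sinner_simps snorm_scaleR power_mult_distrib)
    then show ?thesis by simp
  qed
  have "?r\<^sup>2 \<le> ?p * ?q"
    by (rule nonneg_quadratic_imp_discriminant_le) (simp, rule quad)
  then have "?r\<^sup>2 \<le> (snorm A x * snorm A y)\<^sup>2"
    by (simp add: power_mult_distrib)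
  then show ?thesis
    by (rule power2_le_imp_le) simp
qed

lemma snorm_minus: "snorm A (- x) = snorm A x"
  using snorm_scaleR[of "-1" x] by simp

lemma snorm_triangle: "snorm A (x + y) \<le> snorm A x + snorm A y"
proof (rule power2_le_imp_le)
  show "(snorm A (x + y))\<^sup>2 \<le> (snorm A x + snorm A y)\<^sup>2"
    using Re_sinner_le[of x y] by (simp add: snorm_add_power2 power2_sum)
qed simp

text \<open>
  Multiplying \<open>x\<close> by a unimodular scalar leaves its seminorm unchanged and makes \<open>sinner A x y\<close>
  nonnegative, which reduces the claim to real parts.
\<close>

lemma cmod_sinner_le: "cmod (sinner A x y) \<le> snorm A x * snorm A y"
proof -
  obtain c where c: "cmod c = 1" "c * sinner A x y = of_real (cmod (sinner A x y))"
  proof (cases "sinner A x y = 0")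
    case True
    then show ?thesis using that[of 1] by simp
  next
    case False
    let ?c = "cnj (sinner A x y) / of_real (cmod (sinner A x y))"
    have "?c * sinner A x y = of_real (cmod (sinner A x y))"
      using False complex_norm_square[of "sinner A x y"]
      by (simp add: field_simps power2_eq_square)
    then show ?thesis using that[of ?c] False by (simp add: norm_divide)
  qed
  have "sinner A (c *\<^sub>C x) (c *\<^sub>C x) = (c * cnj c) * sinner A x x"
    by (simp add: sinner_scaleC_left sinner_scaleC_right)
  then have "snorm A (c *\<^sub>C x) = snorm A x"
    using c(1) by (simp add: snorm_def flip: complex_norm_square)
  then show ?thesis
    using Re_sinner_le[of "c *\<^sub>C x" y] c(2) by (simp add: sinner_scaleC_left)
qed

text \<open>
  If \<open>x\<close> has seminorm zero, the Cauchy--Schwarz inequality against \<open>A x\<close> gives \<open>A x = 0\<close>.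
\<close>

lemma exists_unit_vector:
  assumes "A \<noteq> (\<lambda>_. 0)"
  obtains x where "snorm A x = 1"
proof -
  obtain x where x: "A x \<noteq> 0" using assms by auto
  then have "inner (A x) (A x) \<noteq> 0" by simp
  then have "sinner A x (A x) \<noteq> 0"
    unfolding sinner_def by (metis Re_cinner zero_complex.simps(1))
  then have "snorm A x \<noteq> 0"
    using cmod_sinner_le[of x "A x"] by auto
  then have "snorm A ((1 / snorm A x) *\<^sub>R x) = 1"
    by (simp add: snorm_scaleR)
  then show ?thesis by (rule that)
qed

lemma snorm_le_norm: "\<exists>C. \<forall>x. snorm A x \<le> C * norm x"
proof -
  obtain K where K: "0 < K" "\<And>x. norm (A x) \<le> norm x * K"
    using bounded_linear.pos_bounded[OF linear_A] by blast
  have "snorm A x \<le> sqrt K * norm x" for x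
  proof -
    have "Re (sinner A x x) \<le> norm (A x) * norm x"
      by (simp add: sinner_def Re_cinner norm_cauchy_schwarz)
    also have "\<dots> \<le> K * (norm x)\<^sup>2"
      using mult_right_mono[OF K(2), of "norm x" x] by (simp add: power2_eq_square mult_ac)
    finally show ?thesis
      by (simp add: snorm_def real_le_lsqrt real_sqrt_mult power_mult_distrib K(1) less_imp_le)
  qed
  then show ?thesis by blast
qed

section \<open>Boundedness in the seminorm\<close>

text \<open>
  Krein's argument.  Put \<open>b = snorm A (R x) / snorm A x\<close>.  Symmetry and the Cauchy--Schwarz inequality
  give \<open>(snorm A ((R ^^ n) x))\<^sup>2 \<le> snorm A ((R ^^ (2 * n)) x) * snorm A x\<close>, so along the exponents
  \<open>2 ^ n\<close> the seminorms of the iterates grow at least like the powers of \<open>b\<close>.  Up to a constant factor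
  they are dominated by the powers of the norm bound \<open>K\<close>, which therefore is at least \<open>b\<close>.
\<close>

lemma symmetric_imp_snorm_bounded:
  assumes R: "\<And>x. norm (R x) \<le> norm x * K" "0 < K"
    and sym: "\<And>x y. sinner A (R x) y = sinner A x (R y)"
  shows "snorm A (R x) \<le> K * snorm A x"
proof (cases "snorm A x = 0")
  case True
  (* b is not available, but a vector of seminorm zero is orthogonal to all others *)
  have "complex_of_real ((snorm A (R x))\<^sup>2) = sinner A x (R (R x))"
    unfolding sinner_self[symmetric] by (simp add: sym)
  then have "(snorm A (R x))\<^sup>2 = cmod (sinner A x (R (R x)))"
    by (metis norm_of_real abs_power2)
  also have "\<dots> \<le> 0"
    using cmod_sinner_le[of x "R (R x)"] True by simp
  finally show ?thesis using True by simp
next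
  case False
  then have nz: "0 < snorm A x"
    using snorm_nonneg[of x] by linarith
  have sym_pow: "sinner A ((R ^^ n) y) z = sinner A y ((R ^^ n) z)" for n y z
    by (induction n arbitrary: y z) (simp_all add: sym funpow_swap1)
  have log_convex: "(snorm A ((R ^^ n) x))\<^sup>2 \<le> snorm A ((R ^^ (2 * n)) x) * snorm A x" for n
  proof -
    have "complex_of_real ((snorm A ((R ^^ n) x))\<^sup>2) = sinner A ((R ^^ (2 * n)) x) x"
      unfolding sinner_self[symmetric] by (simp add: sym_pow mult_2 funpow_add)
    then have "(snorm A ((R ^^ n) x))\<^sup>2 = cmod (sinner A ((R ^^ (2 * n)) x) x)"
      by (metis norm_of_real abs_power2)
    then show ?thesis using cmod_sinner_le by simp
  qed
  define b where "b = snorm A (R x) / snorm A x"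
  have growth: "b ^ 2 ^ n * snorm A x \<le> snorm A ((R ^^ (2 ^ n)) x)" for n
  proof (induction n)
    case 0
    then show ?case using nz by (simp add: b_def)
  next
    case (Suc n)
    have "(b ^ 2 ^ n * snorm A x)\<^sup>2 \<le> (snorm A ((R ^^ (2 ^ n)) x))\<^sup>2"
      using Suc by (rule power_mono) (simp add: b_def)
    also have "\<dots> \<le> snorm A ((R ^^ (2 ^ Suc n)) x) * snorm A x"
      using log_convex[of "2 ^ n"] by simp
    finally have "(b ^ 2 ^ Suc n * snorm A x) * snorm A x \<le> snorm A ((R ^^ (2 ^ Suc n)) x) * snorm A x"
      by (simp add: power2_eq_square power_mult mult_2 power_add mult_ac)
    then show ?case using nz by simp
  qed
  obtain C where C: "\<And>z. snorm A z \<le> C * norm z"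
    using snorm_le_norm by blast
  have "0 < C * norm x" using C[of x] nz by linarith
  then have "0 < C"
    by (metis norm_ge_zero less_le mult_zero_right zero_less_mult_pos2)
  have norm_pow: "norm ((R ^^ n) x) \<le> K ^ n * norm x" for n
  proof (induction n)
    case (Suc n)
    have "norm ((R ^^ Suc n) x) \<le> norm ((R ^^ n) x) * K" using R(1) by simp
    also have "\<dots> \<le> K ^ n * norm x * K" using Suc R(2) by simp
    finally show ?case by (simp add: mult_ac)
  qed simp
  have "b \<le> K"
  proof (rule ccontr)
    assume "\<not> b \<le> K"
    then have big: "1 < b / K" using R(2) by simp
    obtain n where n: "C * norm x / snorm A x < (b / K) ^ n"
      using real_arch_pow[OF big] by blast
    also have "\<dots> \<le> (b / K) ^ 2 ^ n"
      using big by (intro power_increasing) (auto intro: less_imp_le less_exp)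
    finally have "C * norm x / snorm A x < b ^ 2 ^ n / K ^ 2 ^ n"
      by (simp add: power_divide)
    then have "K ^ 2 ^ n * (C * norm x) < b ^ 2 ^ n * snorm A x"
      using nz R(2) by (simp add: field_simps)
    also have "\<dots> \<le> C * norm ((R ^^ (2 ^ n)) x)"
      using growth C order_trans by blast
    also have "\<dots> \<le> C * (K ^ 2 ^ n * norm x)"
      using norm_pow \<open>0 < C\<close> by simp
    finally show False by (simp add: mult_ac)
  qed
  then show ?thesis using nz by (simp add: b_def field_simps)
qed

end

text \<open>
  Krein's argument needs a symmetric operator, which \<open>T\<close> is not in general.  If
  \<open>A \<circ> S = cadjoint T \<circ> A\<close>, then \<open>S\<close> is an adjoint of \<open>T\<close> for the semi-inner product, and \<open>S \<circ> T\<close>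
  is symmetric for it.  The argument applies to \<open>S \<circ> T\<close>, and it suffices because the square of
  \<open>snorm A (T x)\<close> is the value of \<open>sinner A\<close> at \<open>x\<close> and \<open>S (T x)\<close>.
\<close>

lemma ops_adj_snorm_bounded:
  fixes A T :: "'a::chilbert_space \<Rightarrow> 'a"
  assumes "positive_op A" and "T \<in> \<B>\<^bsub>A\<^esub>"
  obtains c where "\<And>x. snorm A (T x) \<le> c * snorm A x"
proof -
  interpret positive_operator A by unfold_locales fact
  obtain S where T: "bounded_clinear T" and S: "bounded_clinear S"
    and AS: "A \<circ> S = cadjoint T \<circ> A"
    using assms(2) by (auto simp: ops_adj_def)
  have adj: "sinner A (T x) y = sinner A x (S y)" for x y
  proof -
    have "sinner A (T x) y = cinner (T x) (A y)" by (simp add: sinner_def A_symmetric)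
    also have "\<dots> = cinner x (A (S y))"
      using fun_cong[OF AS, of y] by (simp add: cinner_cadjoint[OF T])
    also have "\<dots> = sinner A x (S y)" by (simp add: sinner_def A_symmetric)
    finally show ?thesis .
  qed
  have "bounded_linear (S \<circ> T)"
    using S T unfolding bounded_clinear_def comp_def by (blast intro: bounded_linear_compose)
  then obtain K where K: "0 < K" "\<And>x. norm ((S \<circ> T) x) \<le> norm x * K"
    using bounded_linear.pos_bounded by blast
  have sym: "sinner A ((S \<circ> T) x) y = sinner A x ((S \<circ> T) y)" for x y
    using adj[of x "T y"] adj[of y "T x"]
    by (simp add: sinner_commute[of "S (T x)" y] sinner_commute[of "T x" "T y"])
  have "snorm A (T x) \<le> sqrt K * snorm A x" for x
  proof -
    have "(snorm A (T x))\<^sup>2 = Re (sinner A x (S (T x)))"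
      using adj[of x "T x"] by (simp add: sinner_self complex_eq_iff)
    also have "\<dots> \<le> snorm A x * snorm A (S (T x))" by (rule Re_sinner_le)
    also have "\<dots> \<le> snorm A x * (K * snorm A x)"
      using symmetric_imp_snorm_bounded[OF K(2,1) sym] by (intro mult_left_mono) auto
    also have "\<dots> = (sqrt K * snorm A x)\<^sup>2"
      using K(1) by (simp add: power_mult_distrib) (simp add: power2_eq_square)
    finally have "(snorm A (T x))\<^sup>2 \<le> (sqrt K * snorm A x)\<^sup>2" .
    then show ?thesis
      by (rule power2_le_imp_le) (simp add: K(1) less_imp_le)
  qed
  then show ?thesis by (rule that)
qed

section \<open>The two-by-two scalar model\<close>

lemma exists_minus_inverse_eq:
  fixes t :: real
  assumes "0 \<le> t"
  obtains N where "1 \<le> N" "N - 1 / N = t"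
proof -
  (* the exponential of arsinh (t / 2) *)
  define N where "N = (t + sqrt (t\<^sup>2 + 4)) / 2"
  have "2 \<le> sqrt (t\<^sup>2 + 4)" by (rule real_le_rsqrt) simp
  then have "1 \<le> N" using assms by (simp add: N_def)
  have "N\<^sup>2 = t * N + 1"
    by (simp add: N_def power2_eq_square field_simps)
  then have "N - 1 / N = t"
    using \<open>1 \<le> N\<close> by (simp add: field_simps power2_eq_square)
  then show ?thesis using \<open>1 \<le> N\<close> that by blast
qed

lemma minus_inverse_mono:
  fixes N P :: real
  assumes "1 \<le> N" and "N \<le> P"
  shows "N - 1 / N \<le> P - 1 / P"
proof -
  have "1 / P \<le> 1 / N" using assms by (intro divide_left_mono) auto
  then show ?thesis using assms by linarith
qed

context
  fixes N t :: real
  assumes N: "1 \<le> N" and t: "N - 1 / N = t"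
begin

lemma t_nonneg: "0 \<le> t"
  using minus_inverse_mono[of 1 N] N t by simp

lemma t_mult_N: "t * N = N\<^sup>2 - 1"
  using N t by (auto simp: field_simps power2_eq_square)

text \<open>
  The matrix \<open>N\<^sup>2 I - X\<^sup>T X\<close>, for \<open>X\<close> with rows \<open>(1, t)\<close> and \<open>(0, -1)\<close>, is singular since \<open>N\<close> is a
  singular value of \<open>X\<close>; its quadratic form is therefore a multiple of a single square.
\<close>

lemma model_norm_le: "(a + t * b)\<^sup>2 + b\<^sup>2 \<le> N\<^sup>2 * (a\<^sup>2 + b\<^sup>2)"
proof -
  have "N * (N\<^sup>2 * (a\<^sup>2 + b\<^sup>2) - (a + t * b)\<^sup>2 - b\<^sup>2) = t * (N * a - b)\<^sup>2"
    using t_mult_N by algebra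
  then have "0 \<le> N * (N\<^sup>2 * (a\<^sup>2 + b\<^sup>2) - (a + t * b)\<^sup>2 - b\<^sup>2)"
    using t_nonneg by simp
  then show ?thesis using N by (simp add: zero_le_mult_iff)
qed

text \<open>
  The same mechanism for the symmetric part of \<open>X\<close> and its eigenvalue \<open>(N + 1 / N) / 2\<close>.  The
  absolute value costs nothing, because exchanging \<open>a\<close> and \<open>b\<close> changes the sign of the difference
  of squares and nothing else.
\<close>

lemma model_radius_le: "\<bar>a\<^sup>2 - b\<^sup>2\<bar> + t * a * b \<le> (N + 1 / N) / 2 * (a\<^sup>2 + b\<^sup>2)"
proof -
  have le: "x\<^sup>2 - y\<^sup>2 + t * x * y \<le> (N + 1 / N) / 2 * (x\<^sup>2 + y\<^sup>2)" for x y
  proof -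
    have "2 * N * ((N + 1 / N) / 2 * (x\<^sup>2 + y\<^sup>2) - (x\<^sup>2 - y\<^sup>2 + t * x * y))
        = (N\<^sup>2 + 1) * (x\<^sup>2 + y\<^sup>2) - 2 * N * (x\<^sup>2 - y\<^sup>2) - 2 * (t * N) * x * y"
      using N by (simp add: field_simps power2_eq_square)
    also have "\<dots> = ((N - 1) * x - (N + 1) * y)\<^sup>2"
      unfolding t_mult_N by algebra
    finally have "0 \<le> 2 * N * ((N + 1 / N) / 2 * (x\<^sup>2 + y\<^sup>2) - (x\<^sup>2 - y\<^sup>2 + t * x * y))"
      by simp
    then show ?thesis using N by (simp add: zero_le_mult_iff)
  qed
  show ?thesis
    using le[of a b] le[of b a] by (simp add: abs_if mult_ac add_ac)
qed

text \<open>The maximum is attained at the normalized right singular vector \<open>(1, N)\<close>.\<close>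

lemma model_norm_attained:
  obtains a b :: real where "a\<^sup>2 + b\<^sup>2 = 1" "(a + t * b)\<^sup>2 + b\<^sup>2 = N\<^sup>2"
proof -
  let ?d = "sqrt (1 + N\<^sup>2)"
  have d: "?d\<^sup>2 = 1 + N\<^sup>2" "?d \<noteq> 0" "1 + N\<^sup>2 \<noteq> 0" by (auto simp: add_nonneg_eq_0_iff)
  show ?thesis
  proof (rule that)
    show "(1 / ?d)\<^sup>2 + (N / ?d)\<^sup>2 = 1"
      unfolding power_divide d(1) using d(3) by (simp flip: add_divide_distrib)
    have "1 / ?d + t * (N / ?d) = N\<^sup>2 / ?d"
      using t_mult_N by (simp flip: add_divide_distrib)
    then have "(1 / ?d + t * (N / ?d))\<^sup>2 + (N / ?d)\<^sup>2 = (N\<^sup>2 * (1 + N\<^sup>2)) / (1 + N\<^sup>2)"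
      unfolding \<open>1 / ?d + t * (N / ?d) = _\<close> power_divide d(1)
      by (simp add: algebra_simps power2_eq_square flip: add_divide_distrib)
    then show "(1 / ?d + t * (N / ?d))\<^sup>2 + (N / ?d)\<^sup>2 = N\<^sup>2"
      using d(3) by simp
  qed
qed

text \<open>The maximum is attained at the normalized eigenvector \<open>(N + 1, N - 1)\<close> of the symmetric part.\<close>

lemma model_radius_attained:
  obtains a b :: real where "a\<^sup>2 + b\<^sup>2 = 1" "a\<^sup>2 - b\<^sup>2 + t * a * b = (N + 1 / N) / 2"
proof -
  let ?d = "sqrt (2 * (1 + N\<^sup>2))"
  have d: "?d\<^sup>2 = 2 * (1 + N\<^sup>2)" "1 + N\<^sup>2 \<noteq> 0" by (auto simp: add_nonneg_eq_0_iff)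
  let ?a = "(N + 1) / ?d" and ?b = "(N - 1) / ?d"
  have "?a\<^sup>2 - ?b\<^sup>2 + t * ?a * ?b = ((N + 1)\<^sup>2 - (N - 1)\<^sup>2 + t * (N + 1) * (N - 1)) / ?d\<^sup>2"
  proof -
    have "t * (x / d) * (y / d) = t * x * y / d\<^sup>2" for x y d :: real
      by (simp add: power2_eq_square)
    then show ?thesis
      unfolding power_divide
      by (simp only: add_divide_distrib[of "(N + 1)\<^sup>2 - _"] diff_divide_distrib[of "(N + 1)\<^sup>2"])
  qed
  also have "\<dots> = (1 + N\<^sup>2)\<^sup>2 / N / (2 * (1 + N\<^sup>2))"
  proof -
    have "N * ((N + 1)\<^sup>2 - (N - 1)\<^sup>2 + t * (N + 1) * (N - 1)) = (1 + N\<^sup>2)\<^sup>2"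
      using t_mult_N by algebra
    then have "(N + 1)\<^sup>2 - (N - 1)\<^sup>2 + t * (N + 1) * (N - 1) = (1 + N\<^sup>2)\<^sup>2 / N"
      using N by (simp add: nonzero_eq_divide_eq mult.commute)
    then show ?thesis by (simp only: d(1))
  qed
  also have "\<dots> = (N + 1 / N) / 2"
  proof -
    have cancel: "q\<^sup>2 / N / (2 * q) = q / N / 2" if "q \<noteq> 0" for q
      using that by (simp add: power2_eq_square)
    have "(1 + N\<^sup>2) / N = N + 1 / N"
      using N by (simp add: field_simps power2_eq_square)
    then show ?thesis by (simp only: cancel[OF d(2)])
  qed
  finally have val: "?a\<^sup>2 - ?b\<^sup>2 + t * ?a * ?b = (N + 1 / N) / 2" .
  have "?a\<^sup>2 + ?b\<^sup>2 = ((N + 1)\<^sup>2 + (N - 1)\<^sup>2) / ?d\<^sup>2"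
    by (simp only: power_divide add_divide_distrib[of "(N + 1)\<^sup>2"])
  also have "\<dots> = 1"
    unfolding d(1) using d(2) by (simp add: power2_eq_square algebra_simps)
  finally show ?thesis using val that by blast
qed

end

section \<open>Seminorm and numerical radius of the block operator\<close>

locale snorm_bounded_operator = positive_operator A
  for A :: "'a::complex_inner \<Rightarrow> 'a" +
  fixes T :: "'a \<Rightarrow> 'a" and c :: real
  assumes A_nonzero: "A \<noteq> (\<lambda>_. 0)"
    and T_linear: "linear T"
    and T_bounded: "snorm A (T x) \<le> c * snorm A x"
begin

definition AA :: "'a \<times> 'a \<Rightarrow> 'a \<times> 'a"
  where "AA = block_op A (\<lambda>_. 0) (\<lambda>_. 0) A"

definition M :: "'a \<times> 'a \<Rightarrow> 'a \<times> 'a"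
  where "M = block_op (\<lambda>x. x) T (\<lambda>_. 0) (\<lambda>x. - x)"

lemma T_image_ne: "{snorm A (T x) |x. snorm A x = 1} \<noteq> {}"
  using exists_unit_vector[OF A_nonzero] by blast

lemma T_image_bdd: "bdd_above {snorm A (T x) |x. snorm A x = 1}"
proof (rule bdd_aboveI)
  fix y assume "y \<in> {snorm A (T x) |x. snorm A x = 1}"
  then obtain x where "y = snorm A (T x)" "snorm A x = 1" by blast
  then show "y \<le> c" using T_bounded[of x] by simp
qed

lemma snorm_T_le_unit: "snorm A x = 1 \<Longrightarrow> snorm A (T x) \<le> op_snorm A T"
  unfolding op_snorm_def by (rule cSup_upper[OF _ T_image_bdd]) blast

lemma op_snorm_T_nonneg: "0 \<le> op_snorm A T"
  using exists_unit_vector[OF A_nonzero] snorm_T_le_unit snorm_nonneg by (meson order_trans)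

lemma snorm_T_le: "snorm A (T x) \<le> op_snorm A T * snorm A x"
proof (cases "snorm A x = 0")
  case True
  then show ?thesis using T_bounded[of x] by simp
next
  case False
  then have nz: "0 < snorm A x" using snorm_nonneg[of x] by linarith
  have "snorm A (T ((1 / snorm A x) *\<^sub>R x)) \<le> op_snorm A T"
    using nz by (intro snorm_T_le_unit) (simp add: snorm_scaleR)
  then show ?thesis
    using nz by (simp add: linear_scale[OF T_linear] snorm_scaleR field_simps)
qed

lemma sinner_AA: "sinner AA (x, y) (x', y') = sinner A x x' + sinner A y y'"
  by (simp add: AA_def block_op_def sinner_def cinner_prod_def)

lemma snorm_AA: "snorm AA (x, y) = sqrt ((snorm A x)\<^sup>2 + (snorm A y)\<^sup>2)"
  by (simp add: snorm_def[of AA] sinner_AA sinner_self)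

lemma M_apply: "M (x, y) = (x + T y, - y)"
  by (simp add: M_def block_op_def)

lemma snorm_M_le:
  assumes N: "1 \<le> N" "N - 1 / N = op_snorm A T"
  shows "snorm AA (M (x, y)) \<le> N * snorm AA (x, y)"
proof -
  have "snorm A (x + T y) \<le> snorm A x + op_snorm A T * snorm A y"
    using snorm_triangle[of x "T y"] snorm_T_le[of y] by linarith
  then have "(snorm A (x + T y))\<^sup>2 + (snorm A y)\<^sup>2
      \<le> (snorm A x + op_snorm A T * snorm A y)\<^sup>2 + (snorm A y)\<^sup>2"
    by (intro add_right_mono power_mono) simp_all
  also have "\<dots> \<le> N\<^sup>2 * ((snorm A x)\<^sup>2 + (snorm A y)\<^sup>2)"
    by (rule model_norm_le[OF N])
  finally have "snorm AA (M (x, y)) \<le> sqrt (N\<^sup>2 * ((snorm A x)\<^sup>2 + (snorm A y)\<^sup>2))"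
    by (simp add: M_apply snorm_AA snorm_minus)
  then show ?thesis
    using N(1) by (simp add: snorm_AA real_sqrt_mult)
qed

lemma sinner_M_le:
  assumes N: "1 \<le> N" "N - 1 / N = op_snorm A T"
  shows "cmod (sinner AA (M (x, y)) (x, y)) \<le> (N + 1 / N) / 2 * (snorm AA (x, y))\<^sup>2"
proof -
  have "sinner AA (M (x, y)) (x, y)
      = of_real ((snorm A x)\<^sup>2 - (snorm A y)\<^sup>2) + sinner A (T y) x"
    by (simp add: M_apply sinner_AA sinner_simps sinner_self)
  then have "cmod (sinner AA (M (x, y)) (x, y))
      \<le> \<bar>(snorm A x)\<^sup>2 - (snorm A y)\<^sup>2\<bar> + cmod (sinner A (T y) x)"
    by (metis norm_triangle_ineq norm_of_real)
  also have "cmod (sinner A (T y) x) \<le> snorm A (T y) * snorm A x"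
    by (rule cmod_sinner_le)
  also have "\<dots> \<le> op_snorm A T * snorm A y * snorm A x"
    using snorm_T_le by (intro mult_right_mono) auto
  also have "\<bar>(snorm A x)\<^sup>2 - (snorm A y)\<^sup>2\<bar> + op_snorm A T * snorm A y * snorm A x
      \<le> (N + 1 / N) / 2 * ((snorm A x)\<^sup>2 + (snorm A y)\<^sup>2)"
    using model_radius_le[OF N, of "snorm A x" "snorm A y"] by (simp add: mult_ac)
  finally show ?thesis by (simp add: snorm_AA)
qed

text \<open>
  The vector \<open>u\<close> is \<open>T v\<close> normalized; if \<open>T v\<close> has seminorm zero, it is orthogonal to every vector
  and any unit vector will do.
\<close>

lemma exists_aligned_unit:
  assumes "snorm A v = 1"
  obtains u where "snorm A u = 1" "sinner A (T v) u = of_real (snorm A (T v))"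
proof (cases "snorm A (T v) = 0")
  case True
  then have "sinner A (T v) v = 0"
    using cmod_sinner_le[of "T v" v] by simp
  then show ?thesis using that[of v] assms True by simp
next
  case False
  then show ?thesis
    using that[of "(1 / snorm A (T v)) *\<^sub>R T v"]
    by (simp add: snorm_scaleR sinner_simps sinner_self power2_eq_square)
qed

text \<open>
  Compressing \<open>M\<close> to the span of \<open>(u, 0)\<close> and \<open>(0, v)\<close>, with \<open>u\<close> aligned to \<open>T v\<close>, produces the scalar
  matrix with off-diagonal entry \<open>snorm A (T v)\<close>; the vector \<open>z\<close> has coordinates \<open>a\<close> and \<open>b\<close>.
\<close>

lemma compression:
  assumes "snorm A v = 1" and "a\<^sup>2 + b\<^sup>2 = 1"
  defines "s \<equiv> snorm A (T v)"
  obtains z where "snorm AA z = 1"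
    "snorm AA (M z) = sqrt ((a + s * b)\<^sup>2 + b\<^sup>2)"
    "sinner AA (M z) z = of_real (a\<^sup>2 - b\<^sup>2 + s * a * b)"
proof -
  obtain u where u: "snorm A u = 1" "sinner A (T v) u = of_real s"
    using exists_aligned_unit[OF assms(1)] unfolding s_def by blast
  have u': "sinner A u (T v) = of_real s"
    using u(2) by (simp add: sinner_commute[of u "T v"])
  let ?z = "(a *\<^sub>R u, b *\<^sub>R v)"
  have T: "T (b *\<^sub>R v) = b *\<^sub>R T v" by (rule linear_scale[OF T_linear])
  show ?thesis
  proof (rule that)
    show "snorm AA ?z = 1"
      using assms u by (simp add: snorm_AA snorm_scaleR power_mult_distrib)
    have "(snorm A (a *\<^sub>R u + b *\<^sub>R T v))\<^sup>2 = (a + s * b)\<^sup>2"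
      using u by (simp add: snorm_add_power2 snorm_scaleR power_mult_distrib sinner_simps u'
          power2_sum mult_ac flip: s_def)
    then show "snorm AA (M ?z) = sqrt ((a + s * b)\<^sup>2 + b\<^sup>2)"
      using assms(1) by (simp add: M_apply T snorm_AA snorm_minus snorm_scaleR power_mult_distrib)
    show "sinner AA (M ?z) ?z = of_real (a\<^sup>2 - b\<^sup>2 + s * a * b)"
      using assms(1) u
      by (simp add: M_apply T sinner_AA sinner_simps sinner_self power2_eq_square algebra_simps)
  qed
qed

lemma op_snorm_T_leI:
  assumes "\<And>v. snorm A v = 1 \<Longrightarrow> snorm A (T v) \<le> q"
  shows "op_snorm A T \<le> q"
  unfolding op_snorm_def using T_image_ne assms by (intro cSup_least) auto

text \<open>
  A unit vector at which \<open>T\<close> attains its seminorm need not exist.  For the lower bound, an arbitrary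
  upper bound \<open>P\<close> of the set is therefore converted, by means of the compressions, into the upper
  bound \<open>P - 1 / P\<close> for the seminorm of \<open>T\<close>.
\<close>

lemma op_snorm_M:
  assumes N: "1 \<le> N" "N - 1 / N = op_snorm A T"
  shows "op_snorm AA M = N"
  unfolding op_snorm_def[of AA]
proof (rule cSup_eq_non_empty)
  obtain v where v: "snorm A v = 1" using exists_unit_vector[OF A_nonzero] by blast
  then have "snorm AA (v, 0) = 1"
    using snorm_scaleR[of 0 v] by (simp add: snorm_AA)
  then show "{snorm AA (M z) |z. snorm AA z = 1} \<noteq> {}" by blast
  show "y \<le> N" if y: "y \<in> {snorm AA (M z) |z. snorm AA z = 1}" for y
  proof -
    obtain z where "y = snorm AA (M z)" "snorm AA z = 1" using y by blast
    then show ?thesis using snorm_M_le[OF N, of "fst z" "snd z"] by simp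
  qed
  fix P assume P: "\<And>y. y \<in> {snorm AA (M z) |z. snorm AA z = 1} \<Longrightarrow> y \<le> P"
  have step: "1 \<le> P \<and> snorm A (T v) \<le> P - 1 / P" if v: "snorm A v = 1" for v
  proof -
    obtain n where n: "1 \<le> n" "n - 1 / n = snorm A (T v)"
      using exists_minus_inverse_eq[OF snorm_nonneg] by blast
    obtain a b where ab: "a\<^sup>2 + b\<^sup>2 = 1" "(a + snorm A (T v) * b)\<^sup>2 + b\<^sup>2 = n\<^sup>2"
      using model_norm_attained[OF n] by blast
    obtain z where "snorm AA z = 1" "snorm AA (M z) = sqrt (n\<^sup>2)"
      using compression[OF v ab(1)] ab(2) by metis
    moreover have "snorm AA (M z) \<le> P" using calculation(1) by (intro P) blast
    ultimately have "n \<le> P" using n(1) by simp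
    then show ?thesis using minus_inverse_mono[OF n(1), of P] n by simp
  qed
  then have "1 \<le> P" using v by blast
  have "op_snorm A T \<le> P - 1 / P" using step by (blast intro: op_snorm_T_leI)
  then have le: "N - 1 / N \<le> P - 1 / P" using N(2) by simp
  show "N \<le> P"
  proof (rule ccontr)
    assume "\<not> N \<le> P"
    then have "P < N" by simp
    moreover have "1 / N \<le> 1 / P" using \<open>P < N\<close> \<open>1 \<le> P\<close> by (intro divide_left_mono) auto
    ultimately show False using le by linarith
  qed
qed

text \<open>
  As for the seminorm, an upper bound \<open>P\<close> of the values is converted into one for the seminorm of \<open>T\<close>,
  which here is twice the square root of \<open>P\<^sup>2 - 1\<close>: the hyperbolic cosine is inverted instead of the
  exponential.
\<close>

lemma num_radius_M:
  assumes N: "1 \<le> N" "N - 1 / N = op_snorm A T"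
  shows "\<omega>\<^bsub>AA\<^esub> M = (N + 1 / N) / 2"
  unfolding num_radius_def
proof (rule cSup_eq_non_empty)
  obtain v where v: "snorm A v = 1" using exists_unit_vector[OF A_nonzero] by blast
  then have "snorm AA (v, 0) = 1"
    using snorm_scaleR[of 0 v] by (simp add: snorm_AA)
  then show "{cmod (sinner AA (M z) z) |z. snorm AA z = 1} \<noteq> {}" by blast
  show "y \<le> (N + 1 / N) / 2" if y: "y \<in> {cmod (sinner AA (M z) z) |z. snorm AA z = 1}" for y
  proof -
    obtain z where "y = cmod (sinner AA (M z) z)" "snorm AA z = 1"
      using y by blast
    then show ?thesis using sinner_M_le[OF N, of "fst z" "snd z"] by simp
  qed
  fix P assume P: "\<And>y. y \<in> {cmod (sinner AA (M z) z) |z. snorm AA z = 1} \<Longrightarrow> y \<le> P"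
  (* with n = exp u, this is cosh u ^ 2 = 1 + sinh u ^ 2 *)
  have square: "((n + 1 / n) / 2)\<^sup>2 = 1 + ((n - 1 / n) / 2)\<^sup>2" if "1 \<le> n" for n :: real
    using that by (simp add: field_simps power2_eq_square)
  have step: "0 \<le> P \<and> 1 \<le> P\<^sup>2 \<and> snorm A (T v) \<le> 2 * sqrt (P\<^sup>2 - 1)" if v: "snorm A v = 1" for v
  proof -
    obtain n where n: "1 \<le> n" "n - 1 / n = snorm A (T v)"
      using exists_minus_inverse_eq[OF snorm_nonneg] by blast
    obtain a b where ab: "a\<^sup>2 + b\<^sup>2 = 1" "a\<^sup>2 - b\<^sup>2 + snorm A (T v) * a * b = (n + 1 / n) / 2"
      using model_radius_attained[OF n] by blast
    obtain z where z: "snorm AA z = 1" "sinner AA (M z) z = of_real ((n + 1 / n) / 2)"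
      using compression[OF v ab(1)] ab(2) by metis
    have n0: "0 \<le> (n + 1 / n) / 2" using n(1) by simp
    have "cmod (sinner AA (M z) z) = (n + 1 / n) / 2"
      unfolding z(2) norm_of_real using n0 by simp
    moreover have "cmod (sinner AA (M z) z) \<le> P" using z(1) by (intro P) blast
    ultimately have le: "(n + 1 / n) / 2 \<le> P" by simp
    then have "((n + 1 / n) / 2)\<^sup>2 \<le> P\<^sup>2" using n0 by (rule power_mono)
    then have sq: "1 + (snorm A (T v) / 2)\<^sup>2 \<le> P\<^sup>2" using square[OF n(1)] n(2) by simp
    then have "snorm A (T v) / 2 \<le> sqrt (P\<^sup>2 - 1)" by (intro real_le_rsqrt) simp
    moreover have "1 \<le> P\<^sup>2" using sq zero_le_power2[of "snorm A (T v) / 2"] by linarith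
    ultimately show ?thesis using le n0 by simp
  qed
  have P1: "0 \<le> P" "1 \<le> P\<^sup>2" using step[OF v] by auto
  have "op_snorm A T \<le> 2 * sqrt (P\<^sup>2 - 1)" using step by (blast intro: op_snorm_T_leI)
  then have "(op_snorm A T / 2)\<^sup>2 \<le> (sqrt (P\<^sup>2 - 1))\<^sup>2"
    using op_snorm_T_nonneg by (intro power_mono) auto
  then have "((N + 1 / N) / 2)\<^sup>2 \<le> P\<^sup>2"
    using square[OF N(1)] N(2) P1(2) by simp
  then show "(N + 1 / N) / 2 \<le> P" using P1(1) by (rule power2_le_imp_le)
qed

end

theorem theorem2p3:
  fixes A T :: "'a::chilbert_space \<Rightarrow> 'a"
  defines "AA \<equiv> block_op A (\<lambda>_. 0) (\<lambda>_. 0) A"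
    and "M \<equiv> block_op (\<lambda>x. x) T (\<lambda>_. 0) (\<lambda>x. - x)"
  assumes "positive_op A"
    and "A \<noteq> (\<lambda>_. 0)"
    and "T \<in> \<B>\<^bsub>A\<^esub>"
    and "invariant_under T (orth_complement (null_space A))"
  shows "\<omega>\<^bsub>AA\<^esub> M = 1 / 2 * (op_snorm AA M + inverse (op_snorm AA M))"
proof -
  obtain c where c: "\<And>x. snorm A (T x) \<le> c * snorm A x"
    using ops_adj_snorm_bounded assms(3,5) by blast
  have "linear T"
    using assms(5) by (auto simp: ops_adj_def bounded_clinear_def bounded_linear.linear)
  then interpret block: snorm_bounded_operator A T c
    using assms(3,4) c
    by (intro snorm_bounded_operator.intro positive_operator.intro
        snorm_bounded_operator_axioms.intro)
  obtain N where N: "1 \<le> N" "N - 1 / N = op_snorm A T"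
    using exists_minus_inverse_eq[OF block.op_snorm_T_nonneg] by blast
  have "op_snorm AA M = N" "\<omega>\<^bsub>AA\<^esub> M = (N + 1 / N) / 2"
    using block.op_snorm_M[OF N] block.num_radius_M[OF N]
    unfolding block.AA_def block.M_def AA_def M_def by auto
  then show ?thesis by (simp add: inverse_eq_divide)
qed

end
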